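(* Let $p>2$ be a prime number and $n\ge 3$ a positive integer, and let $$M(p^n)=\langle x,y\mid x^{p^{n-1}}=y^p=1,\ y^{-1}xy=x^{1+p^{n-2}}\rangle$$ be the modular $p$-group of order $p^n$. Then the number $f_2(M(p^n))$ of exact factorizations of $M(p^n)$ is equal to $1$.
   Context: An exact factorization of a finite group $G$ is a pair $(H,K)$ of subgroups of $G$ with $G=HK$ and $H\cap K=1$; in counting, only factorizations in which both $H$ and $K$ are nontrivial are considered. Two exact factorizations $(H,K)$ and $(L,M)$ of $G$ are equivalent if either $H\cong L$ and $K\cong M$, or $H\cong M$ and $K\cong L$ (abstract group isomorphisms). $f_2(G)$ denotes the number of equivalence classes of exact factorizations of $G$. *)

theory Defs
  imports "HOL-Algebra.Coset" "HOL-Computational_Algebra.Primes"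
begin

text \<open>Group words: the letter \<open>(a, True)\<close> stands for the generator \<open>a\<close> and \<open>(a, False)\<close> for its
  formal inverse. A relation \<open>u = v\<close> is a pair of words.\<close>

type_synonym 'a gword = "('a \<times> bool) list"

inductive pres_eq :: "('a gword \<times> 'a gword) set \<Rightarrow> 'a gword \<Rightarrow> 'a gword \<Rightarrow> bool"
  for R where
  rel: "(u, v) \<in> R \<Longrightarrow> pres_eq R u v"
| cancel: "pres_eq R [(a, e), (a, \<not> e)] []"
| refl: "pres_eq R u u"
| sym: "pres_eq R u v \<Longrightarrow> pres_eq R v u"
| trans: "pres_eq R u v \<Longrightarrow> pres_eq R v w \<Longrightarrow> pres_eq R u w"
| append: "pres_eq R u u' \<Longrightarrow> pres_eq R v v' \<Longrightarrow> pres_eq R (u @ v) (u' @ v')"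

definition pres_rel :: "('a gword \<times> 'a gword) set \<Rightarrow> ('a gword \<times> 'a gword) set" where
  "pres_rel R = {(u, v). pres_eq R u v}"

text \<open>The group with generators all elements of the type \<open>'a\<close> and defining relations \<open>R\<close>.\<close>

definition presented_group :: "('a gword \<times> 'a gword) set \<Rightarrow> 'a gword set monoid" where
  "presented_group R =
    \<lparr>carrier = UNIV // pres_rel R,
     monoid.mult = (\<lambda>A B. \<Union>u\<in>A. \<Union>v\<in>B. pres_rel R `` {u @ v}),
     one = pres_rel R `` {[]}\<rparr>"

lemma equiv_pres_rel: "equiv UNIV (pres_rel R)"
  unfolding pres_rel_def
  by (auto intro!: equivI refl_onI symI transI intro: pres_eq.refl pres_eq.sym pres_eq.trans)

lemma presented_group_mult:
  "pres_rel R `` {u} \<otimes>\<^bsub>presented_group R\<^esub> pres_rel R `` {v} = pres_rel R `` {u @ v}"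
proof -
  have "congruent2 (pres_rel R) (pres_rel R) (\<lambda>u v. pres_rel R `` {u @ v})"
  proof (rule congruent2I')
    fix u u' v v' assume "(u, u') \<in> pres_rel R" "(v, v') \<in> pres_rel R"
    then have "(u @ v, u' @ v') \<in> pres_rel R"
      by (auto simp: pres_rel_def intro: pres_eq.append)
    then show "pres_rel R `` {u @ v} = pres_rel R `` {u' @ v'}"
      by (rule equiv_class_eq [OF equiv_pres_rel])
  qed
  from UN_equiv_class2 [OF equiv_pres_rel equiv_pres_rel this]
  show ?thesis by (simp add: presented_group_def)
qed

lemma inverse_word: "pres_eq R (rev (map (\<lambda>(a, e). (a, \<not> e)) u) @ u) []"
proof (induction u)
  case Nil
  then show ?case by (simp add: pres_eq.refl)
next
  case (Cons l u)
  obtain a e where l: "l = (a, e)" by force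
  let ?v = "rev (map (\<lambda>(a, e). (a, \<not> e)) u)"
  have "pres_eq R ([(a, \<not> e), (a, e)] @ u) ([] @ u)"
    using pres_eq.cancel [of R a "\<not> e"] by (intro pres_eq.append pres_eq.refl) simp
  then have "pres_eq R (?v @ [(a, \<not> e), (a, e)] @ u) (?v @ u)"
    by (intro pres_eq.append pres_eq.refl) simp
  from pres_eq.trans [OF this Cons.IH] show ?case by (simp add: l)
qed

lemma group_presented_group: "group (presented_group R)"
proof (rule groupI)
  let ?G = "presented_group R"
  have cl: "\<exists>u. A = pres_rel R `` {u}" if "A \<in> carrier ?G" for A
    using that by (auto simp: presented_group_def quotient_def)
  have mem: "pres_rel R `` {u} \<in> carrier ?G" for u
    by (simp add: presented_group_def quotientI)
  have one: "\<one>\<^bsub>?G\<^esub> = pres_rel R `` {[]}"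
    by (simp add: presented_group_def)
  show "\<one>\<^bsub>?G\<^esub> \<in> carrier ?G" by (simp only: one mem)
  fix A assume "A \<in> carrier ?G"
  then obtain u where A: "A = pres_rel R `` {u}" using cl by blast
  show "\<one>\<^bsub>?G\<^esub> \<otimes>\<^bsub>?G\<^esub> A = A" by (simp add: A one presented_group_mult)
  have "(rev (map (\<lambda>(a, e). (a, \<not> e)) u) @ u, []) \<in> pres_rel R"
    by (simp add: pres_rel_def inverse_word)
  from equiv_class_eq [OF equiv_pres_rel this]
  show "\<exists>B\<in>carrier ?G. B \<otimes>\<^bsub>?G\<^esub> A = \<one>\<^bsub>?G\<^esub>"
    using mem by (auto simp: A one presented_group_mult intro!: bexI)
  fix B assume "B \<in> carrier ?G"
  then obtain v where B: "B = pres_rel R `` {v}" using cl by blast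
  show "A \<otimes>\<^bsub>?G\<^esub> B \<in> carrier ?G" by (simp add: A B presented_group_mult mem)
  fix C assume "C \<in> carrier ?G"
  then obtain w where C: "C = pres_rel R `` {w}" using cl by blast
  show "A \<otimes>\<^bsub>?G\<^esub> B \<otimes>\<^bsub>?G\<^esub> C = A \<otimes>\<^bsub>?G\<^esub> (B \<otimes>\<^bsub>?G\<^esub> C)"
    by (simp add: A B C presented_group_mult)
qed

datatype gen_xy = X | Y

text \<open>\<open>modular_group p n\<close> is \<open>M(p^n)\<close>; it is the intended group only for \<open>n \<ge> 2\<close>, because of the
  truncated subtractions in the exponents.\<close>

definition modular_group :: "nat \<Rightarrow> nat \<Rightarrow> gen_xy gword set monoid" where
  "modular_group p n = presented_group
    {(replicate (p ^ (n - 1)) (X, True), []),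
     (replicate p (Y, True), []),
     ([(Y, False), (X, True), (Y, True)], replicate (1 + p ^ (n - 2)) (X, True))}"

definition exact_factorizations :: "('a, 'b) monoid_scheme \<Rightarrow> ('a set \<times> 'a set) set" where
  "exact_factorizations G =
    {(H, K). subgroup H G \<and> subgroup K G \<and> carrier G = H <#>\<^bsub>G\<^esub> K \<and> H \<inter> K = {\<one>\<^bsub>G\<^esub>}}"

text \<open>Only factorizations with both factors nontrivial are counted.\<close>

definition nontrivial_exact_factorizations ::
    "('a, 'b) monoid_scheme \<Rightarrow> ('a set \<times> 'a set) set" where
  "nontrivial_exact_factorizations G =
    {(H, K) \<in> exact_factorizations G. H \<noteq> {\<one>\<^bsub>G\<^esub>} \<and> K \<noteq> {\<one>\<^bsub>G\<^esub>}}"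

definition subgroups_iso :: "('a, 'b) monoid_scheme \<Rightarrow> 'a set \<Rightarrow> 'a set \<Rightarrow> bool" where
  "subgroups_iso G H L \<longleftrightarrow> G\<lparr>carrier := H\<rparr> \<cong> G\<lparr>carrier := L\<rparr>"

definition factorization_equiv ::
    "('a, 'b) monoid_scheme \<Rightarrow> (('a set \<times> 'a set) \<times> ('a set \<times> 'a set)) set" where
  "factorization_equiv G =
    {((H, K), (L, M)).
      (H, K) \<in> nontrivial_exact_factorizations G \<and>
      (L, M) \<in> nontrivial_exact_factorizations G \<and>
      (subgroups_iso G H L \<and> subgroups_iso G K M \<or>
       subgroups_iso G H M \<and> subgroups_iso G K L)}"

definition f2 :: "('a, 'b) monoid_scheme \<Rightarrow> nat" where
  "f2 G = card (nontrivial_exact_factorizations G // factorization_equiv G)"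

lemma equiv_factorization_equiv:
  assumes "group G"
  shows "equiv (nontrivial_exact_factorizations G) (factorization_equiv G)"
proof -
  interpret group G by fact
  have sg: "group (G\<lparr>carrier := H\<rparr>)" "group (G\<lparr>carrier := K\<rparr>)"
    if "(H, K) \<in> nontrivial_exact_factorizations G" for H K
    using that subgroup.subgroup_is_group [OF _ assms]
    by (auto simp: nontrivial_exact_factorizations_def exact_factorizations_def)
  have sy: "subgroups_iso G B A"
    if "group (G\<lparr>carrier := A\<rparr>)" "subgroups_iso G A B" for A B
    using that group.iso_sym unfolding subgroups_iso_def by blast
  have tr: "subgroups_iso G A C"
    if "subgroups_iso G A B" "subgroups_iso G B C" for A B C
    using that iso_trans unfolding subgroups_iso_def by blast
  have rf: "subgroups_iso G A A" for A
    by (simp add: subgroups_iso_def iso_refl)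
  show ?thesis
  proof (rule equivI)
    show "factorization_equiv G \<subseteq>
        nontrivial_exact_factorizations G \<times> nontrivial_exact_factorizations G"
      by (auto simp: factorization_equiv_def)
    show "refl_on (nontrivial_exact_factorizations G) (factorization_equiv G)"
      by (auto simp: refl_on_def factorization_equiv_def rf)
    show "sym (factorization_equiv G)"
      by (rule symI) (auto simp: factorization_equiv_def dest: sg intro: sy)
    show "trans (factorization_equiv G)"
      by (rule transI) (auto simp: factorization_equiv_def intro: tr)
  qed
qed

end

theory Submission
  imports Defs "HOL-Algebra.Multiplicative_Group" "HOL-Number_Theory.Cong"
begin

text \<open>Every element of \<open>M(p\<^sup>n)\<close> is \<open>y\<^sup>j x\<^sup>i\<close> for a unique \<open>j\<close> modulo \<open>p\<close> and \<open>i\<close> modulo \<open>p\<^bsup>n-1\<^esup>\<close>, and the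
  residue of \<open>i\<close> modulo \<open>p\<close> is a homomorphism. If \<open>M(p\<^sup>n) = H K\<close>, one factor, say \<open>H\<close>, therefore contains
  some \<open>y\<^sup>j x\<^sup>i\<close> with \<open>i\<close> prime to \<open>p\<close>. As \<open>p\<close> is odd, \<open>(y\<^sup>j x\<^sup>i)\<^sup>p = x\<^bsup>p i\<^esup>\<close>, so this element has order
  \<open>p\<^bsup>n-1\<^esup>\<close>. Since \<open>\<bar>H\<bar> \<bar>K\<bar> = p\<^sup>n\<close> and \<open>K\<close> is nontrivial, it generates \<open>H\<close>, and \<open>K\<close> is cyclic of order \<open>p\<close>.\<close>

section \<open>Powers of p, cyclic subgroups and products of subgroups\<close>

text \<open>Since m + 1 <= 2m for positive m. This kills every second-order term in the twist by
  \<open>p^m\<close>.\<close>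

lemma power_Suc_dvd_square:
  fixes p m :: nat
  assumes "m > 0"
  shows "p ^ Suc m dvd p ^ m * p ^ m"
  unfolding power_add [symmetric] using assms by (intro le_imp_power_dvd) simp

text \<open>The map \<open>a^k\<close> to \<open>b^k\<close> is well defined and injective because
  equal orders make the same pairs of exponents coincide. Infinite order is covered, with
  \<open>ord\<close> equal to 0.\<close>

lemma (in group) generate_singleton_iso:
  assumes a: "a \<in> carrier G" and b: "b \<in> carrier G" and eq: "ord a = ord b"
  shows "subgroups_iso G (generate G {a}) (generate G {b})"
proof -
  \<comment> \<open>\<open>SOME\<close> selects one exponent of z with respect to a; by
    \<open>pow_iff\<close> its image does not depend on the selection.\<close>
  define f where "f z = b [^] (SOME k::int. a [^] k = z)" for z
  have pow_iff: "a [^] k = a [^] l \<longleftrightarrow> b [^] k = b [^] l" for k l :: int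
    using a b eq by (simp add: int_pow_eq)
  have f_pow: "f (a [^] k) = b [^] k" for k :: int
  proof -
    have "a [^] (SOME l::int. a [^] l = a [^] k) = a [^] k"
      by (rule someI [of "\<lambda>l. a [^] l = a [^] k"]) simp
    then show ?thesis
      by (simp add: f_def pow_iff)
  qed
  have A: "generate G {a} = range (\<lambda>k::int. a [^] k)"
    and B: "generate G {b} = range (\<lambda>k::int. b [^] k)"
    using a b by (auto simp: generate_pow)
  have "f \<in> iso (G\<lparr>carrier := generate G {a}\<rparr>) (G\<lparr>carrier := generate G {b}\<rparr>)"
  proof (rule isoI)
    show "f \<in> hom (G\<lparr>carrier := generate G {a}\<rparr>) (G\<lparr>carrier := generate G {b}\<rparr>)"
      using a b by (intro homI) (auto simp: A B f_pow simp flip: int_pow_mult)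
    show "bij_betw f (carrier (G\<lparr>carrier := generate G {a}\<rparr>)) (carrier (G\<lparr>carrier := generate G {b}\<rparr>))"
      by (auto simp: A B bij_betw_def inj_on_def f_pow pow_iff image_image)
  qed
  then show ?thesis
    unfolding subgroups_iso_def is_iso_def by blast
qed

lemma (in group) card_subgroup_dvd:
  assumes "subgroup H G" "subgroup K G" "H \<subseteq> K"
  shows "card H dvd card K"
proof -
  have "subgroup H (G\<lparr>carrier := K\<rparr>)"
    by (rule subgroup_incl [OF assms])
  from group.lagrange [OF subgroup_imp_group [OF assms(2)] this]
  have "card (rcosets\<^bsub>G\<lparr>carrier := K\<rparr>\<^esub> H) * card H = card K"
    by (simp add: order_def)
  then show ?thesis
    by (metis dvd_triv_right)
qed

lemma (in group) ord_dvd_card_subgroup: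
  assumes "subgroup H G" "a \<in> H"
  shows "ord a dvd card H"
proof -
  have "a \<in> carrier G"
    using assms by (rule subgroup.mem_carrier)
  then show ?thesis
    using card_subgroup_dvd [OF generate_is_subgroup assms(1)] generate_subgroup_incl [OF _ assms(1)]
      generate_pow_card assms(2) by auto
qed

lemma (in group) generate_eq_subgroup:
  assumes "subgroup H G" "a \<in> H" "finite H" "ord a = card H"
  shows "generate G {a} = H"
proof (rule card_subset_eq)
  show "generate G {a} \<subseteq> H"
    using assms by (intro generate_subgroup_incl) auto
  show "card (generate G {a}) = card H"
    using assms generate_pow_card subgroup.mem_carrier by metis
qed fact

lemma (in group) prime_card_subgroup_cyclic:
  assumes H: "subgroup H G" and p: "Factorial_Ring.prime (card H)"
  obtains a where "a \<in> H" "ord a = card H" "generate G {a} = H"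
proof -
  have fin: "finite H"
    using p by (meson card_ge_0_finite prime_gt_0_nat)
  have "H \<noteq> {\<one>}"
    using p by auto
  then obtain a where a: "a \<in> H" "a \<noteq> \<one>"
    using subgroup.one_closed [OF H] by blast
  then have "ord a \<noteq> 1"
    using H ord_eq_1 subgroup.mem_carrier by metis
  then have "ord a = card H"
    using ord_dvd_card_subgroup [OF H a(1)] p prime_nat_iff by blast
  with that a generate_eq_subgroup [OF H a(1) fin] show thesis
    by blast
qed

text \<open>If h k = h' k', then \<open>inv h' h = k' inv k\<close> lies in both H and K, hence is
  trivial; so multiplication is injective on H x K.\<close>

lemma (in group) card_set_mult_subgroups:
  assumes H: "subgroup H G" and K: "subgroup K G" and HK: "H \<inter> K = {\<one>}"
  shows "card (H <#> K) = card H * card K"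
proof -
  have "inj_on (\<lambda>(h, k). h \<otimes> k) (H \<times> K)"
  proof (rule inj_onI, clarify)
    fix h k h' k'
    assume mem: "h \<in> H" "k \<in> K" "h' \<in> H" "k' \<in> K" and eq: "h \<otimes> k = h' \<otimes> k'"
    note cl = mem(1,3) [THEN subgroup.mem_carrier [OF H]] mem(2,4) [THEN subgroup.mem_carrier [OF K]]
    have "h = (h' \<otimes> k') \<otimes> inv k"
      using cl eq by (simp add: inv_solve_right)
    then have "inv h' \<otimes> h = k' \<otimes> inv k"
      using cl by (simp add: inv_solve_left' m_assoc)
    moreover have "inv h' \<otimes> h \<in> H" "k' \<otimes> inv k \<in> K"
      using mem H K by (simp_all add: subgroup.m_closed subgroup.m_inv_closed)
    ultimately have "inv h' \<otimes> h = \<one>" "k' \<otimes> inv k = \<one>"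
      using HK by auto
    then show "h = h' \<and> k = k'"
      using cl inv_solve_left [of \<one> h' h] inv_solve_right [of \<one> k' k] by simp
  qed
  then have "card ((\<lambda>(h, k). h \<otimes> k) ` (H \<times> K)) = card H * card K"
    by (simp add: card_image card_cartesian_product)
  moreover have "H <#> K = (\<lambda>(h, k). h \<otimes> k) ` (H \<times> K)"
    by (auto simp: set_mult_def)
  ultimately show ?thesis
    by simp
qed

section \<open>Exact factorizations of a group with modular coordinates\<close>

text \<open>In the application \<open>c j i\<close> is \<open>y\<^sup>j x\<^sup>i\<close> in \<open>M(p\<^sup>n)\<close> with \<open>n = m + 2\<close>.\<close>

locale modular_coordinates = group G for G (structure) +
  fixes c :: "nat \<Rightarrow> nat \<Rightarrow> 'a" and p m :: nat
  assumes prime: "Factorial_Ring.prime p" and odd: "p > 2" and m_pos: "m > 0"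
    and c_closed: "c j i \<in> carrier G"
    and c_surj: "z \<in> carrier G \<Longrightarrow> \<exists>j i. z = c j i"
    and c_mult: "c j i \<otimes> c l k = c (j + l) (i + i * l * p ^ m + k)"
    and c_eq_iff: "c j i = c j' i' \<longleftrightarrow> [j = j'] (mod p) \<and> [i = i'] (mod p ^ Suc m)"
begin

lemma c_0_0: "c 0 0 = \<one>"
  using c_mult [of 0 0 0 0] c_closed by (simp add: l_cancel_one)

lemma c_eq_one_iff: "c j i = \<one> \<longleftrightarrow> p dvd j \<and> p ^ Suc m dvd i"
  unfolding c_0_0 [symmetric] c_eq_iff by (simp add: cong_0_iff)

text \<open>Appending one more factor to the k-th power moves \<open>y^j\<close> past about
  \<open>x^(k i)\<close> and adds \<open>k i j p^m\<close> to the exponent; the sum 0 + ... + (k-1)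
  is the binomial coefficient. The remaining term contains \<open>p^(2m)\<close> and
  vanishes.\<close>

lemma c_pow: "c j i [^] (k::nat) = c (k * j) (k * i + i * j * p ^ m * (k choose 2))"
proof (induction k)
  case 0
  then show ?case by (simp add: c_0_0 numeral_2_eq_2)
next
  case (Suc k)
  have "p ^ Suc m dvd (p ^ m * p ^ m) * (i * j * (k choose 2) * j)"
    using power_Suc_dvd_square [OF m_pos] by (rule dvd_mult2)
  then have "[i * j * p ^ m * (k choose 2) * j * p ^ m = 0] (mod p ^ Suc m)"
    by (simp add: cong_0_iff mult_ac)
  moreover have "Suc k choose 2 = (k choose 2) + k"
    by (simp add: numeral_2_eq_2)
  ultimately show ?case
    using cong_add [OF cong_refl [of "Suc k * i + i * j * p ^ m * ((k choose 2) + k)"]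
        \<open>[i * j * p ^ m * (k choose 2) * j * p ^ m = 0] (mod p ^ Suc m)\<close>]
    by (simp add: Suc c_mult c_eq_iff algebra_simps)
qed

text \<open>For odd p the binomial coefficient in \<open>c_pow\<close> with k = p is divisible by p,
  so the twist disappears at the p-th power. That power has no y-part, and further powers only scale
  the exponent of x.\<close>

lemma c_pow_prime_power:
  "c j i [^] (p ^ Suc k) = c 0 (p ^ Suc k * i)"
proof -
  have "p dvd (p choose 2)"
    using prime odd by (intro dvd_choose_prime) auto
  then have "[p * i + i * j * p ^ m * (p choose 2) = p * i + 0] (mod p ^ Suc m)"
    by (intro cong_add cong_refl) (auto simp: cong_0_iff elim!: dvdE)
  then have "c j i [^] p = c 0 (p * i)"
    by (simp add: c_pow c_eq_iff cong_0_iff)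
  then have "(c j i [^] p) [^] (p ^ k) = c 0 (p ^ k * (p * i))"
    by (simp add: c_pow)
  then show ?thesis
    by (simp add: nat_pow_pow c_closed mult_ac)
qed

text \<open>Residues j below p and i below \<open>p^(m+1)\<close> represent each element exactly
  once.\<close>

lemma finite_carrier: "finite (carrier G)"
  and order_eq: "order G = p ^ (m + 2)"
proof -
  have p0: "p > 0"
    using odd by simp
  let ?f = "\<lambda>(j, i). c j i"
  have "bij_betw ?f ({..<p} \<times> {..<p ^ Suc m}) (carrier G)"
    unfolding bij_betw_def
  proof
    show "inj_on ?f ({..<p} \<times> {..<p ^ Suc m})"
      by (auto simp: inj_on_def c_eq_iff cong_def)
    have "c j i \<in> ?f ` ({..<p} \<times> {..<p ^ Suc m})" for j i
    proof -
      have "c j i = ?f (j mod p, i mod p ^ Suc m)"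
        by (simp add: c_eq_iff cong_def)
      moreover have "(j mod p, i mod p ^ Suc m) \<in> {..<p} \<times> {..<p ^ Suc m}"
        using p0 by (simp del: power_Suc)
      ultimately show ?thesis
        by (rule image_eqI)
    qed
    then have "carrier G \<subseteq> ?f ` ({..<p} \<times> {..<p ^ Suc m})"
      using c_surj by blast
    then show "?f ` ({..<p} \<times> {..<p ^ Suc m}) = carrier G"
      using c_closed by auto
  qed
  from bij_betw_finite [OF this] bij_betw_same_card [OF this]
  show "finite (carrier G)" "order G = p ^ (m + 2)"
    by (simp_all add: order_def)
qed

text \<open>The order is a power of p dividing \<open>p^(m+1)\<close>. Were it smaller,
  \<open>x^(p^m i)\<close> would be trivial, which forces p to divide i.\<close>

lemma ord_c:
  assumes "\<not> p dvd i"
  shows "ord (c j i) = p ^ Suc m"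
proof -
  have "c j i [^] (p ^ Suc m) = \<one>"
    unfolding c_pow_prime_power by (simp add: c_eq_one_iff)
  then have "ord (c j i) dvd p ^ Suc m"
    using pow_eq_id c_closed by blast
  then obtain r where r: "r \<le> Suc m" "ord (c j i) = p ^ r"
    using prime divides_primepow_nat by blast
  \<comment> \<open>\<open>c_pow_prime_power\<close> speaks only of positive powers of p, so m is
    written as a successor.\<close>
  obtain k where k: "m = Suc k"
    using m_pos gr0_implies_Suc by blast
  have "\<not> r \<le> m"
  proof
    assume "r \<le> m"
    then have "ord (c j i) dvd p ^ Suc k"
      using r k by (simp add: le_imp_power_dvd del: power_Suc)
    then have "c j i [^] (p ^ Suc k) = \<one>"
      using pow_eq_id c_closed by blast
    then have "p ^ m * p dvd p ^ m * i"
      unfolding c_pow_prime_power c_eq_one_iff k by (simp add: mult_ac)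
    then show False
      using assms odd by simp
  qed
  with r show ?thesis
    by (simp add: le_Suc_eq)
qed

text \<open>The order \<open>p^(m+1)\<close> of \<open>c j i\<close> divides \<open>card H\<close>,
  so with cofactor t the cardinalities leave \<open>t * card K = p\<close>. As K is nontrivial, t =
  1.\<close>

lemma cyclic_factors:
  assumes H: "subgroup H G" and K: "subgroup K G" "K \<noteq> {\<one>}"
    and card: "card H * card K = p ^ (m + 2)"
    and h: "c j i \<in> H" "\<not> p dvd i"
  obtains a b where "a \<in> carrier G" "b \<in> carrier G" "ord a = p ^ Suc m" "ord b = p"
    "H = generate G {a}" "K = generate G {b}"
proof -
  have p0: "p > 0"
    using odd by simp
  have fin: "finite K" "finite H"
    using finite_carrier H K(1) finite_subset subgroup.subset by blast+
  obtain t where t: "card H = p ^ Suc m * t"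
    using ord_dvd_card_subgroup [OF H h(1)] ord_c [OF h(2)] by auto
  with card p0 have tK: "t * card K = p"
    by simp
  have "card K \<noteq> 1"
    using K subgroup.one_closed card_1_singletonE by (metis singletonD)
  then have "card K = p"
    using tK prime by (metis dvd_triv_right prime_nat_iff)
  with tK t p0 have "card H = p ^ Suc m"
    by simp
  with generate_eq_subgroup [OF H h(1)] ord_c [OF h(2)] fin
  have "generate G {c j i} = H"
    by simp
  moreover obtain b where "b \<in> K" "ord b = p" "generate G {b} = K"
    using prime_card_subgroup_cyclic [OF K(1)] prime \<open>card K = p\<close> by metis
  ultimately show thesis
    using that c_closed ord_c [OF h(2)] subgroup.mem_carrier [OF K(1)] by metis
qed

text \<open>The second coordinate is additive modulo \<open>p\<close>, so it cannot vanish modulo \<open>p\<close> on both factors.\<close>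

lemma exact_factorization_cyclic:
  assumes "(H, K) \<in> nontrivial_exact_factorizations G"
  obtains a b where "a \<in> carrier G" "b \<in> carrier G" "ord a = p ^ Suc m" "ord b = p"
    "(H = generate G {a} \<and> K = generate G {b}) \<or> (H = generate G {b} \<and> K = generate G {a})"
proof -
  have H: "subgroup H G" "H \<noteq> {\<one>}" and K: "subgroup K G" "K \<noteq> {\<one>}"
    and HK: "carrier G = H <#> K" "H \<inter> K = {\<one>}"
    using assms by (auto simp: nontrivial_exact_factorizations_def exact_factorizations_def)
  have card: "card H * card K = p ^ (m + 2)"
    using card_set_mult_subgroups [OF H(1) K(1) HK(2)] HK(1) order_eq by (simp add: order_def)
  \<comment> \<open>The element \<open>c 0 1\<close> is x, with second coordinate 1. If p divided
    the second coordinates i and r of both factors, it would divide that of the product, since the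
    twist has the factor i.\<close>
  obtain h k where hk: "h \<in> H" "k \<in> K" "c 0 1 = h \<otimes> k"
    using HK(1) c_closed [of 0 1] by (auto simp: set_mult_def)
  obtain j i l r where h: "h = c j i" and k: "k = c l r"
    using hk c_surj H(1) K(1) subgroup.mem_carrier by metis
  have "[1 = i + i * l * p ^ m + r] (mod p ^ Suc m)"
    using hk(3) by (simp add: h k c_mult c_eq_iff)
  then have "[1 = i + i * l * p ^ m + r] (mod p)"
    by (rule cong_dvd_modulus_nat) simp
  moreover have "\<not> [1 = 0] (mod p)"
    using odd by (simp add: cong_def)
  ultimately have "\<not> p dvd i \<or> \<not> p dvd r"
    by (metis cong_0_iff cong_trans dvd_add dvd_mult2)
  then show thesis
  proof
    assume "\<not> p dvd i"
    with cyclic_factors [OF H(1) K card] hk h that show thesis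
      by metis
  next
    assume "\<not> p dvd r"
    with cyclic_factors [OF K(1) H] card hk k that show thesis
      by (metis mult.commute)
  qed
qed

text \<open>The witness is the subgroup generated by y times the one generated by x. It ensures that
  there is a class to count.\<close>

lemma exact_factorization_exists: "nontrivial_exact_factorizations G \<noteq> {}"
proof -
  have pow: "c 0 1 [^] k = c 0 k" "c 1 0 [^] k = c k 0" for k :: nat
    by (simp_all add: c_pow)
  \<comment> \<open>In a finite group natural powers of an element already exhaust the subgroup it
    generates.\<close>
  have gen: "generate G {c 0 1} = range (c 0)" "generate G {c 1 0} = range (\<lambda>j. c j 0)"
    unfolding generate_pow_on_finite_carrier [OF finite_carrier c_closed] pow by auto
  define H K where "H = range (c 0)" and "K = range (\<lambda>j. c j 0)"
  have "subgroup H G" "subgroup K G"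
    using c_closed unfolding H_def K_def gen [symmetric] by (auto intro: generate_is_subgroup)
  moreover have "K <#> H = carrier G"
  proof -
    have "c j i \<in> K <#> H" for j i
      using c_mult [of j 0 0 i, symmetric] unfolding set_mult_def H_def K_def by simp blast
    then show ?thesis
      using c_surj c_closed by (auto simp: set_mult_def H_def K_def) blast
  qed
  moreover have "K \<inter> H = {\<one>}"
    using c_0_0 by (auto simp: H_def K_def c_eq_iff c_eq_one_iff cong_0_iff simp flip: c_0_0)
  moreover have "K \<noteq> {\<one>}" "H \<noteq> {\<one>}"
  proof -
    have "c 1 0 \<noteq> \<one>" "c 0 1 \<noteq> \<one>"
      using odd by (simp_all add: c_eq_one_iff)
    then show "K \<noteq> {\<one>}" "H \<noteq> {\<one>}"
      unfolding H_def K_def by blast+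
  qed
  ultimately have "(K, H) \<in> nontrivial_exact_factorizations G"
    by (simp add: nontrivial_exact_factorizations_def exact_factorizations_def)
  then show ?thesis
    by blast
qed

text \<open>Each factorization consists of cyclic groups of orders \<open>p^(m+1)\<close> and p in
  one of the two orders, and equivalence permits a swap. So the relation is total on a nonempty set
  and has one class.\<close>

lemma f2_eq_1: "f2 G = 1"
proof -
  let ?N = "nontrivial_exact_factorizations G"
  have "factorization_equiv G = ?N \<times> ?N"
  proof
    show "factorization_equiv G \<subseteq> ?N \<times> ?N"
      by (auto simp: factorization_equiv_def)
    show "?N \<times> ?N \<subseteq> factorization_equiv G"
    proof clarify
      fix H K L M
      assume N: "(H, K) \<in> ?N" "(L, M) \<in> ?N"
      from N(1) obtain a b where ab: "a \<in> carrier G" "b \<in> carrier G" "ord a = p ^ Suc m" "ord b = p"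
        "(H = generate G {a} \<and> K = generate G {b}) \<or> (H = generate G {b} \<and> K = generate G {a})"
        by (rule exact_factorization_cyclic)
      from N(2) obtain d e where de: "d \<in> carrier G" "e \<in> carrier G" "ord d = p ^ Suc m" "ord e = p"
        "(L = generate G {d} \<and> M = generate G {e}) \<or> (L = generate G {e} \<and> M = generate G {d})"
        by (rule exact_factorization_cyclic)
      have "subgroups_iso G (generate G {a}) (generate G {d})"
        "subgroups_iso G (generate G {b}) (generate G {e})"
        using ab de by (auto intro: generate_singleton_iso)
      with N ab de show "((H, K), (L, M)) \<in> factorization_equiv G"
        by (auto simp: factorization_equiv_def)
    qed
  qed
  then have "?N // factorization_equiv G = {?N}"
    using exact_factorization_exists by (auto simp: quotient_def)
  then show ?thesis
    by (simp add: f2_def)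
qed

end

section \<open>Normal forms from the defining relations\<close>

text \<open>The relations give the product rule, and \<open>gen\<close> makes the normal forms
  exhaust the group. Relations alone cannot exclude a collapse, so distinctness of normal forms
  enters as \<open>inj\<close> and is later supplied by a model.\<close>

lemma (in group) modular_coordinates_power_products:
  assumes prime: "Factorial_Ring.prime p" "p > 2" and m_pos: "m > 0"
    and x: "x \<in> carrier G" and y: "y \<in> carrier G"
    and x_pow: "x [^] (p ^ Suc m) = \<one>" and y_pow: "y [^] p = \<one>"
    and rel: "inv y \<otimes> x \<otimes> y = x [^] (1 + p ^ m)"
    and gen: "\<And>H. subgroup H G \<Longrightarrow> x \<in> H \<Longrightarrow> y \<in> H \<Longrightarrow> H = carrier G"
    and inj: "\<And>j i j' i'. y [^] j \<otimes> x [^] i = y [^] j' \<otimes> x [^] i' \<Longrightarrow>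
      [j = j'] (mod p) \<and> [i = i'] (mod p ^ Suc m)"
  shows "modular_coordinates G (\<lambda>j i. y [^] j \<otimes> x [^] i) p m"
proof -
  define q where "q = p ^ m"
  define c where "c j i = y [^] j \<otimes> x [^] i" for j i :: nat
  have closed: "c j i \<in> carrier G" for j i
    using x y by (simp add: c_def)
  have x_cong: "x [^] i = x [^] i'" if "[i = i'] (mod p ^ Suc m)" for i i' :: nat
  proof -
    have "x [^] i = x [^] (i mod p ^ Suc m)" for i :: nat
      using x x_pow
      by (metis (no_types, lifting) div_mult_mod_eq l_one mult.commute nat_pow_closed nat_pow_mult
          nat_pow_one nat_pow_pow)
    then show ?thesis
      using that by (metis cong_def)
  qed
  have y_cong: "y [^] j = y [^] j'" if "[j = j'] (mod p)" for j j' :: nat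
  proof -
    have "y [^] j = y [^] (j mod p)" for j :: nat
      using y y_pow
      by (metis (no_types, lifting) div_mult_mod_eq l_one mult.commute nat_pow_closed nat_pow_mult
          nat_pow_one nat_pow_pow)
    then show ?thesis
      using that by (metis cong_def)
  qed
  have xy: "x \<otimes> y = y \<otimes> x [^] (1 + q)"
    using rel x y unfolding q_def [symmetric] by (metis inv_closed inv_solve_left m_assoc m_closed nat_pow_closed)
  have x_pow_y: "x [^] i \<otimes> y = y \<otimes> x [^] (i * (1 + q))" for i :: nat
  proof (induction i)
    case (Suc i)
    have "x [^] Suc i \<otimes> y = x [^] i \<otimes> (x \<otimes> y)"
      using x y by (simp add: m_assoc)
    also have "\<dots> = (x [^] i \<otimes> y) \<otimes> x [^] (1 + q)"
      using x y by (simp add: xy m_assoc)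
    also have "\<dots> = y \<otimes> (x [^] (i * (1 + q)) \<otimes> x [^] (1 + q))"
      unfolding Suc using x y by (intro m_assoc nat_pow_closed)
    also have "\<dots> = y \<otimes> x [^] (Suc i * (1 + q))"
      unfolding nat_pow_mult [OF x] by (simp only: mult_Suc add.commute)
    finally show ?case .
  qed (use x y in simp)
  have q_sq: "p ^ Suc m dvd q * q"
    unfolding q_def using m_pos by (rule power_Suc_dvd_square)
  \<comment> \<open>Passing \<open>y^l\<close> multiplies the exponent by \<open>(1 + q)^l\<close>,
    which is \<open>1 + l q\<close> modulo \<open>p^(m+1)\<close> because \<open>q^2\<close>
    vanishes.\<close>
  have x_pow_y_pow: "x [^] i \<otimes> y [^] l = y [^] l \<otimes> x [^] (i + i * l * q)" for i l :: nat
  proof (induction l)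
    case (Suc l)
    have "[i * l * q * q = 0] (mod p ^ Suc m)"
      using q_sq by (simp add: cong_0_iff mult.assoc dvd_mult del: power_Suc)
    from cong_add [OF cong_refl this, of "i + i * Suc l * q"]
    have "[(i + i * l * q) * (1 + q) = i + i * Suc l * q] (mod p ^ Suc m)"
      by (simp add: algebra_simps)
    note red = x_cong [OF this]
    have "x [^] i \<otimes> y [^] Suc l = (x [^] i \<otimes> y [^] l) \<otimes> y"
      using x y by (simp add: m_assoc)
    also have "\<dots> = y [^] l \<otimes> (x [^] (i + i * l * q) \<otimes> y)"
      using x y by (simp add: Suc m_assoc)
    also have "\<dots> = y [^] Suc l \<otimes> x [^] ((i + i * l * q) * (1 + q))"
      unfolding x_pow_y using x y by (simp add: m_assoc)
    finally show ?case
      unfolding red .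
  qed (use x y in simp)
  have mult: "c j i \<otimes> c l k = c (j + l) (i + i * l * q + k)" for j i l k
  proof -
    have "c j i \<otimes> c l k = y [^] j \<otimes> (x [^] i \<otimes> y [^] l) \<otimes> x [^] k"
      using x y by (simp add: c_def m_assoc)
    then show ?thesis
      unfolding x_pow_y_pow using x y by (simp add: c_def m_assoc nat_pow_mult flip: nat_pow_mult)
  qed
  have eq_iff: "c j i = c j' i' \<longleftrightarrow> [j = j'] (mod p) \<and> [i = i'] (mod p ^ Suc m)" for j i j' i'
    using inj x_cong y_cong unfolding c_def by metis
  have one: "c 0 0 = \<one>"
    by (simp add: c_def)
  define H where "H = range (case_prod c)"
  have c_H: "c j i \<in> H" for j i
    by (auto simp: H_def)
  have "subgroup H G"
  proof (rule subgroupI)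
    show "H \<subseteq> carrier G"
      using closed by (auto simp: H_def)
    show "H \<noteq> {}"
      using c_H by blast
    show "a \<otimes> b \<in> H" if "a \<in> H" "b \<in> H" for a b
      using that by (auto simp: H_def mult intro: c_H [unfolded H_def])
    show "inv a \<in> H" if a: "a \<in> H" for a
    proof -
      obtain j i where a: "a = c j i"
        using a by (auto simp: H_def)
      \<comment> \<open>Exponents are natural numbers, so l represents -j modulo p and k represents
        \<open>-(i + i l q)\<close> modulo \<open>p^(m+1)\<close>.\<close>
      define l where "l = j * (p - 1)"
      define k where "k = (i + i * l * q) * (p ^ Suc m - 1)"
      have minus_1: "t + t * (r - Suc 0) = t * r" if "r > 0" for t r :: nat
        using that by (cases r) auto
      have "p > 0"
        using prime by simp
      then have "j + l = j * p" "i + i * l * q + k = (i + i * l * q) * p ^ Suc m"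
        unfolding l_def k_def by (simp_all add: minus_1 del: power_Suc)
      then have "c j i \<otimes> c l k = c 0 0"
        by (simp add: mult eq_iff cong_0_iff del: power_Suc)
      then have "inv a = c l k"
        unfolding a one using closed by (metis inv_equality inv_comm)
      then show ?thesis
        using c_H by simp
    qed
  qed
  moreover have "x \<in> H" "y \<in> H"
    using c_H [of 0 1] c_H [of 1 0] x y by (simp_all add: c_def)
  ultimately have "H = carrier G"
    by (rule gen)
  then have "\<exists>j i. z = c j i" if "z \<in> carrier G" for z
  proof -
    have "z \<in> range (case_prod c)"
      using that \<open>H = carrier G\<close> by (simp add: H_def)
    then show ?thesis
      by auto
  qed
  then have "modular_coordinates G c p m"
    using prime m_pos closed mult eq_iff unfolding q_def by unfold_locales
  then show ?thesis
    by (simp add: c_def [abs_def])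
qed

section \<open>Words and generators in a presented group\<close>

abbreviation pres_class :: "('a gword \<times> 'a gword) set \<Rightarrow> 'a gword \<Rightarrow> 'a gword set" where
  "pres_class R u \<equiv> pres_rel R `` {u}"

lemma pres_class_eq_iff: "pres_class R u = pres_class R v \<longleftrightarrow> pres_eq R u v"
  unfolding eq_equiv_class_iff [OF equiv_pres_rel UNIV_I UNIV_I] by (simp add: pres_rel_def)

lemma pres_class_closed: "pres_class R u \<in> carrier (presented_group R)"
  by (simp add: presented_group_def quotientI)

lemma presented_group_one: "\<one>\<^bsub>presented_group R\<^esub> = pres_class R []"
  by (simp add: presented_group_def)

lemma pres_class_replicate:
  "pres_class R (replicate k l) = pres_class R [l] [^]\<^bsub>presented_group R\<^esub> k"
proof -
  interpret group "presented_group R"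
    by (rule group_presented_group)
  show ?thesis
  proof (induction k)
    case (Suc k)
    have "pres_class R (replicate k l @ [l]) =
        pres_class R (replicate k l) \<otimes>\<^bsub>presented_group R\<^esub> pres_class R [l]"
      by (simp only: presented_group_mult)
    then show ?case
      by (simp add: Suc replicate_append_same)
  qed (simp add: presented_group_one)
qed

lemma pres_class_inverse_letter:
  "pres_class R [(a, False)] = inv\<^bsub>presented_group R\<^esub> pres_class R [(a, True)]"
proof -
  interpret group "presented_group R"
    by (rule group_presented_group)
  have "pres_class R [(a, False)] \<otimes>\<^bsub>presented_group R\<^esub> pres_class R [(a, True)] = \<one>\<^bsub>presented_group R\<^esub>"
    using pres_eq.cancel [of R a False]
    by (simp add: presented_group_mult presented_group_one pres_class_eq_iff)
  then show ?thesis
    by (simp add: inv_equality pres_class_closed)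
qed

text \<open>Induction on words: a negative letter is the inverse of a generator, and a word is the
  product of its letters.\<close>

lemma presented_group_generators:
  assumes H: "subgroup H (presented_group R)" and gen: "\<And>a. pres_class R [(a, True)] \<in> H"
  shows "H = carrier (presented_group R)"
proof
  interpret group "presented_group R"
    by (rule group_presented_group)
  have letter: "pres_class R [l] \<in> H" for l
    using gen subgroup.m_inv_closed [OF H gen]
    by (cases l; cases "snd l") (auto simp: pres_class_inverse_letter)
  have "pres_class R u \<in> H" for u
  proof (induction u)
    case Nil
    then show ?case
      using subgroup.one_closed [OF H] by (simp add: presented_group_one)
  next
    case (Cons l u)
    then show ?case
      using subgroup.m_closed [OF H letter Cons.IH] by (simp add: presented_group_mult)
  qed
  then show "carrier (presented_group R) \<subseteq> H"
    by (auto simp: presented_group_def quotient_def)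
  show "H \<subseteq> carrier (presented_group R)"
    using H by (rule subgroup.subset)
qed

section \<open>An integer coordinate model separating the normal forms\<close>

text \<open>A model of \<open>M(p\<^sup>n)\<close>, \<open>n = m + 2\<close>, in which \<open>(j, i)\<close> stands for \<open>y\<^sup>j x\<^sup>i\<close> and \<open>q = p\<^sup>m\<close>. It is a
  group only modulo \<open>coord_cong p m\<close>: associativity needs \<open>q\<^sup>2\<close> to vanish.\<close>

fun coord_mult :: "int \<Rightarrow> int \<times> int \<Rightarrow> int \<times> int \<Rightarrow> int \<times> int" where
  "coord_mult q (j, i) (l, k) = (j + l, i + i * l * q + k)"

fun coord_letter :: "gen_xy \<times> bool \<Rightarrow> int \<times> int" where
  "coord_letter (X, e) = (0, if e then 1 else -1)"
| "coord_letter (Y, e) = (if e then 1 else -1, 0)"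

text \<open>The product of the letters is nested to the right; integer entries let an inverse letter
  contribute -1.\<close>

definition coord :: "int \<Rightarrow> gen_xy gword \<Rightarrow> int \<times> int" where
  "coord q u = foldr (\<lambda>l. coord_mult q (coord_letter l)) u (0, 0)"

definition coord_cong :: "nat \<Rightarrow> nat \<Rightarrow> int \<times> int \<Rightarrow> int \<times> int \<Rightarrow> bool" where
  "coord_cong p m s t \<longleftrightarrow> [fst s = fst t] (mod int p) \<and> [snd s = snd t] (mod int (p ^ Suc m))"

lemma coord_cong_refl: "coord_cong p m s s"
  by (simp add: coord_cong_def)

lemma coord_cong_sym: "coord_cong p m s t \<Longrightarrow> coord_cong p m t s"
  by (simp add: coord_cong_def cong_sym)

lemma coord_cong_trans: "coord_cong p m s t \<Longrightarrow> coord_cong p m t r \<Longrightarrow> coord_cong p m s r"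
  unfolding coord_cong_def using cong_trans by blast

text \<open>The delicate term is the twist: l is known only modulo p, but \<open>l p^m\<close> is
  then determined modulo \<open>p^(m+1)\<close>.\<close>

lemma coord_mult_cong:
  assumes "coord_cong p m s s'" "coord_cong p m t t'"
  shows "coord_cong p m (coord_mult (int (p ^ m)) s t) (coord_mult (int (p ^ m)) s' t')"
proof -
  obtain j i j' i' l k l' k' where st: "s = (j, i)" "s' = (j', i')" "t = (l, k)" "t' = (l', k')"
    by (metis surj_pair)
  have c: "[j = j'] (mod int p)" "[i = i'] (mod int (p ^ Suc m))"
    "[l = l'] (mod int p)" "[k = k'] (mod int (p ^ Suc m))"
    using assms by (simp_all add: coord_cong_def st)
  have "[l * int (p ^ m) = l' * int (p ^ m)] (mod int (p ^ Suc m))"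
    using c(3) by (auto simp: cong_iff_dvd_diff mult_dvd_mono simp flip: left_diff_distrib)
  then have "[i * (l * int (p ^ m)) = i' * (l' * int (p ^ m))] (mod int (p ^ Suc m))"
    using c(2) by (rule cong_mult [rotated])
  then show ?thesis
    using c by (simp add: coord_cong_def st cong_add mult.assoc del: power_Suc of_nat_power)
qed

text \<open>First coordinates agree exactly; the second ones differ by a multiple of
  \<open>q^2\<close>.\<close>

lemma coord_mult_assoc:
  assumes "m > 0"
  shows "coord_cong p m (coord_mult (int (p ^ m)) (coord_mult (int (p ^ m)) s t) r)
    (coord_mult (int (p ^ m)) s (coord_mult (int (p ^ m)) t r))"
proof -
  obtain j i l k u v where str: "s = (j, i)" "t = (l, k)" "r = (u, v)"
    by (metis surj_pair)
  define q where "q = int (p ^ m)"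
  have "int (p ^ Suc m) dvd q * q"
    using power_Suc_dvd_square [OF assms, of p] unfolding q_def of_nat_mult [symmetric] of_nat_dvd_iff .
  moreover have "snd (coord_mult q (coord_mult q s t) r) - snd (coord_mult q s (coord_mult q t r))
      = q * q * (i * l * u)"
    by (simp add: str algebra_simps)
  ultimately show ?thesis
    unfolding q_def [symmetric] by (simp add: coord_cong_def cong_iff_dvd_diff str add_ac del: power_Suc of_nat_power)
qed

lemma coord_Nil [simp]: "coord q [] = (0, 0)"
  and coord_Cons [simp]: "coord q (l # u) = coord_mult q (coord_letter l) (coord q u)"
  by (simp_all add: coord_def)

text \<open>Concatenation rebrackets the right-nested product, so it is respected only up to
  \<open>coord_cong\<close>.\<close>

lemma coord_append:
  assumes "m > 0"
  shows "coord_cong p m (coord (int (p ^ m)) (u @ v))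
    (coord_mult (int (p ^ m)) (coord (int (p ^ m)) u) (coord (int (p ^ m)) v))"
proof (induction u)
  case Nil
  show ?case
    by (cases "coord (int (p ^ m)) v") (simp add: coord_cong_refl)
next
  case (Cons l u)
  have "coord_cong p m (coord (int (p ^ m)) ((l # u) @ v))
      (coord_mult (int (p ^ m)) (coord_letter l)
        (coord_mult (int (p ^ m)) (coord (int (p ^ m)) u) (coord (int (p ^ m)) v)))"
    using coord_mult_cong [OF coord_cong_refl Cons] by simp
  from coord_cong_trans [OF this coord_cong_sym [OF coord_mult_assoc [OF assms]]]
  show ?case
    by simp
qed

lemma coord_replicate_X: "coord q (replicate i (X, True)) = (0, int i)"
  by (induction i) simp_all

text \<open>With all Y letters on the left no twist arises, so the coordinates recover the exponents
  of a normal form.\<close>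

lemma coord_power_product: "coord q (replicate j (Y, True) @ replicate i (X, True)) = (int j, int i)"
  by (induction j) (simp_all add: coord_replicate_X)

text \<open>The argument of von Dyck's theorem at the level of words: the model satisfies the
  defining relations and its product respects \<open>coord_cong\<close>, so no separate quotient
  group has to be built.\<close>

lemma coord_respects_relations:
  assumes "m > 0"
    and "pres_eq {(replicate (p ^ Suc m) (X, True), []), (replicate p (Y, True), []),
      ([(Y, False), (X, True), (Y, True)], replicate (1 + p ^ m) (X, True))} u v"
  shows "coord_cong p m (coord (int (p ^ m)) u) (coord (int (p ^ m)) v)"
  using assms(2)
proof (induction rule: pres_eq.induct)
  \<comment> \<open>The two power relations hold modulo \<open>p^(m+1)\<close> and p; the
    conjugation relation holds exactly, both sides having coordinates
    \<open>(0, 1 + q)\<close>.\<close>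
  case (rel u v)
  have "coord (int (p ^ m)) (replicate p (Y, True)) = (int p, 0)"
    using coord_power_product [of _ p 0] by simp
  with rel show ?case
    by (auto simp: coord_replicate_X coord_cong_def cong_0_iff simp del: replicate_Suc power_Suc)
next
  case (cancel a e)
  then show ?case
    by (cases a; cases e) (simp_all add: coord_cong_def)
next
  case (append u u' v v')
  from coord_cong_trans [OF coord_append [OF assms(1)] coord_mult_cong [OF append.IH]]
  show ?case
    by (rule coord_cong_trans) (rule coord_cong_sym [OF coord_append [OF assms(1)]])
qed (auto intro: coord_cong_refl coord_cong_sym coord_cong_trans)

section \<open>Transfer to the presented group\<close>

theorem theorem2p9:
  fixes p n :: nat
  assumes "Factorial_Ring.prime p" and "p > 2" and "n \<ge> 3"
  shows "f2 (modular_group p n) = 1"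
proof -
  \<comment> \<open>From n >= 3 comes m > 0, and the truncated subtractions become m and m +
    1.\<close>
  define m where "m = n - 2"
  have m: "m > 0" "n - 1 = Suc m" "n - 2 = m"
    using assms(3) by (auto simp: m_def)
  define R where "R = {(replicate (p ^ Suc m) (X, True), []), (replicate p (Y, True), []),
      ([(Y, False), (X, True), (Y, True)], replicate (1 + p ^ m) (X, True))}"
  define G where "G = presented_group R"
  define x y where "x = pres_class R [(X, True)]" and "y = pres_class R [(Y, True)]"
  interpret group G
    unfolding G_def by (rule group_presented_group)
  have relD: "pres_class R u = pres_class R v" if "(u, v) \<in> R" for u v
    using that by (simp add: pres_class_eq_iff pres_eq.rel)
  note to_group = pres_class_replicate [of R, folded G_def]
    presented_group_mult [of R, folded G_def] presented_group_one [of R, folded G_def]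
  have "modular_coordinates G (\<lambda>j i. y [^]\<^bsub>G\<^esub> j \<otimes>\<^bsub>G\<^esub> x [^]\<^bsub>G\<^esub> i) p m"
  proof (rule modular_coordinates_power_products)
    show "x \<in> carrier G" "y \<in> carrier G"
      by (simp_all add: G_def x_def y_def pres_class_closed)
    show "x [^]\<^bsub>G\<^esub> (p ^ Suc m) = \<one>\<^bsub>G\<^esub>"
      unfolding x_def to_group(1) [symmetric] to_group(3) by (rule relD) (simp add: R_def)
    show "y [^]\<^bsub>G\<^esub> p = \<one>\<^bsub>G\<^esub>"
      unfolding y_def to_group(1) [symmetric] to_group(3) by (rule relD) (simp add: R_def)
    have "pres_class R ([(Y, False)] @ [(X, True)] @ [(Y, True)]) = x [^]\<^bsub>G\<^esub> (1 + p ^ m)"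
      using relD [of "[(Y, False), (X, True), (Y, True)]" "replicate (1 + p ^ m) (X, True)"]
      unfolding x_def pres_class_replicate [of R, folded G_def, symmetric] by (simp add: R_def)
    moreover have "pres_class R ([(Y, False)] @ [(X, True)] @ [(Y, True)]) = inv\<^bsub>G\<^esub> y \<otimes>\<^bsub>G\<^esub> x \<otimes>\<^bsub>G\<^esub> y"
      unfolding x_def y_def G_def pres_class_inverse_letter [symmetric] presented_group_mult
      by simp
    ultimately show "inv\<^bsub>G\<^esub> y \<otimes>\<^bsub>G\<^esub> x \<otimes>\<^bsub>G\<^esub> y = x [^]\<^bsub>G\<^esub> (1 + p ^ m)"
      by simp
    show "H = carrier G" if "subgroup H G" "x \<in> H" "y \<in> H" for H
      unfolding G_def
    proof (rule presented_group_generators)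
      show "pres_class R [(a, True)] \<in> H" for a
        using that by (cases a) (simp_all add: x_def y_def)
    qed (use that in \<open>simp add: G_def\<close>)
    show "[j = j'] (mod p) \<and> [i = i'] (mod p ^ Suc m)"
      if "y [^]\<^bsub>G\<^esub> j \<otimes>\<^bsub>G\<^esub> x [^]\<^bsub>G\<^esub> i = y [^]\<^bsub>G\<^esub> j' \<otimes>\<^bsub>G\<^esub> x [^]\<^bsub>G\<^esub> i'" for j i j' i'
    proof -
      \<comment> \<open>An equality of normal forms in G is read as an equivalence of words, whose
        coordinates are then compared in the model.\<close>
      have "pres_eq R (replicate j (Y, True) @ replicate i (X, True))
          (replicate j' (Y, True) @ replicate i' (X, True))"
        using that unfolding x_def y_def pres_class_replicate [of R, folded G_def, symmetric]
        by (simp only: presented_group_mult [of R, folded G_def] pres_class_eq_iff)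
      from coord_respects_relations [OF m(1) this [unfolded R_def]]
      show ?thesis
        by (simp add: coord_power_product coord_cong_def cong_int_iff del: power_Suc of_nat_power)
    qed
  qed (use assms m in auto)
  then have "f2 G = 1"
    by (rule modular_coordinates.f2_eq_1)
  then show ?thesis
    unfolding modular_group_def m G_def R_def .
qed

end
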